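(* Let $A$ be a connected abelian Lie group without compact factor, acting linearly and by symmetric operators on a finite-dimensional real inner product space $(V,\langle\cdot,\cdot\rangle)$. Then for every $v\in V\smallsetminus\{0\}$, $$m_{\mathfrak a}(A\cdot v)=\operatorname{int}(\operatorname{CH}(\mathfrak R(v))).$$
   Context: $\mathfrak a=\operatorname{Lie}(A)$ (so $A=\exp(\mathfrak a)$), equipped with a fixed inner product $\langle\!\langle\cdot,\cdot\rangle\!\rangle$; $\pi:\mathfrak a\to\mathfrak{gl}(V)$ is the differential of the action, and each $\pi(X)$, $X\in\mathfrak a$, is symmetric with respect to $\langle\cdot,\cdot\rangle$. The moment map $m_{\mathfrak a}:V\smallsetminus\{0\}\to\mathfrak a$ is defined by $\langle\!\langle m_{\mathfrak a}(v),X\rangle\!\rangle=\frac{1}{\|v\|^2}\langle\pi(X)v,v\rangle$ for all $X\in\mathfrak a$. The commuting symmetric operators $\pi(X)$ give an orthogonal decomposition $V=\bigoplus_{\alpha\in\Delta(V)}V_\alpha$, with $\Delta(V)\subset\mathfrak a$ finite and $V_\alpha=\{v\in V:\pi(X)v=\langle\!\langle X,\alpha\rangle\!\rangle v\ \forall X\in\mathfrak a\}\neq0$. For $v=\sum_\alpha v_\alpha\neq 0$ with $v_\alpha\in V_\alpha$, $\mathfrak R(v)=\{\alpha\in\Delta(V):v_\alpha\neq0\}$. For a finite set $\Phi\subset\mathfrak a$, $\operatorname{CH}(\Phi)$ is its convex hull and $\operatorname{int}(\operatorname{CH}(\Phi))$ is the interior of $\operatorname{CH}(\Phi)$ relative to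 the affine hull of $\Phi$. *)

theory Defs
  imports "HOL-Analysis.Analysis"
begin

primrec Ck_on :: "nat \<Rightarrow> 'a::real_normed_vector set \<Rightarrow> ('a \<Rightarrow> 'b::real_normed_vector) \<Rightarrow> bool" where
  "Ck_on 0 S f \<longleftrightarrow> continuous_on S f"
| "Ck_on (Suc k) S f \<longleftrightarrow> (\<forall>x\<in>S. f differentiable (at x)) \<and>
     (\<forall>u. Ck_on k S (\<lambda>x. frechet_derivative f (at x) u))"

(* Only applied to open sets and functions with finite-dimensional domain, where this is the
   usual notion of C^infinity. *)
definition smooth_on :: "'a::real_normed_vector set \<Rightarrow> ('a \<Rightarrow> 'b::real_normed_vector) \<Rightarrow> bool" where
  "smooth_on S f \<longleftrightarrow> (\<forall>k. Ck_on k S f)"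

(* A chart is a pair of its domain and its coordinate map; the values of the coordinate map
   outside the domain are irrelevant. *)
type_synonym ('g, 'a) chart = "'g set \<times> ('g \<Rightarrow> 'a)"

definition chart_image :: "('g, 'a) chart \<Rightarrow> 'a set" where
  "chart_image c = snd c ` fst c"

definition chart_inv :: "('g, 'a) chart \<Rightarrow> 'a \<Rightarrow> 'g" where
  "chart_inv c = inv_into (fst c) (snd c)"

definition is_chart :: "('g::topological_space, 'a::real_normed_vector) chart \<Rightarrow> bool" where
  "is_chart c \<longleftrightarrow> open (fst c) \<and> open (chart_image c) \<and>
     homeomorphism (fst c) (chart_image c) (snd c) (chart_inv c)"

(* Abelian Lie groups, written additively: the underlying group is the whole type 'g. The model
   space 'a is only required to be finite-dimensional (rather than a euclidean_space) so that
   dimension 0, i.e. the trivial connected group, is included. *)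
locale abelian_Lie_group =
  fixes atlas :: "('g::{topological_ab_group_add, t2_space, second_countable_topology},
                   'a::real_normed_vector) chart set"
  assumes finite_dim: "\<exists>B :: 'a set. finite B \<and> span B = UNIV"
    and charts: "c \<in> atlas \<Longrightarrow> is_chart c"
    and cover: "(\<Union>c\<in>atlas. fst c) = UNIV"
    and compatible: "c \<in> atlas \<Longrightarrow> d \<in> atlas \<Longrightarrow>
          smooth_on (snd c ` (fst c \<inter> fst d)) (\<lambda>x. snd d (chart_inv c x))"
    and smooth_add: "c \<in> atlas \<Longrightarrow> d \<in> atlas \<Longrightarrow> e \<in> atlas \<Longrightarrow>
          smooth_on {p \<in> chart_image c \<times> chart_image d.
                       chart_inv c (fst p) + chart_inv d (snd p) \<in> fst e}
            (\<lambda>p. snd e (chart_inv c (fst p) + chart_inv d (snd p)))"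
    and smooth_uminus: "c \<in> atlas \<Longrightarrow> d \<in> atlas \<Longrightarrow>
          smooth_on {x \<in> chart_image c. - chart_inv c x \<in> fst d}
            (\<lambda>x. snd d (- chart_inv c x))"

definition add_subgroup :: "'g::ab_group_add set \<Rightarrow> bool" where
  "add_subgroup H \<longleftrightarrow> 0 \<in> H \<and> (\<forall>x\<in>H. \<forall>y\<in>H. x - y \<in> H)"

(* No nontrivial compact K with 'g = K x H. For closed subgroups K, H that meet in 0 and generate the
   group, with K compact, addition K x H -> 'g is automatically an isomorphism of Lie groups. *)
definition no_compact_factor :: "'g::topological_ab_group_add itself \<Rightarrow> bool" where
  "no_compact_factor (_ :: 'g itself) \<longleftrightarrow>
     (\<forall>K H :: 'g set. add_subgroup K \<and> add_subgroup H \<and> compact K \<and> closed H \<and>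
        K \<inter> H = {0} \<and> (\<forall>g. \<exists>k\<in>K. \<exists>h\<in>H. g = k + h) \<longrightarrow> K = {0})"

definition smooth_linear_action ::
    "('g::topological_ab_group_add, 'a::real_normed_vector) chart set \<Rightarrow>
     ('g \<Rightarrow> 'v::real_normed_vector \<Rightarrow> 'v) \<Rightarrow> bool" where
  "smooth_linear_action atlas \<rho> \<longleftrightarrow>
     (\<forall>g. linear (\<rho> g)) \<and> \<rho> 0 = id \<and> (\<forall>g h. \<rho> (g + h) = \<rho> g \<circ> \<rho> h) \<and>
     (\<forall>c\<in>atlas. smooth_on (chart_image c \<times> UNIV) (\<lambda>p. \<rho> (chart_inv c (fst p)) (snd p)))"

definition symmetric_op :: "('v::real_inner \<Rightarrow> 'v) \<Rightarrow> bool" where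
  "symmetric_op f \<longleftrightarrow> (\<forall>u w. f u \<bullet> w = u \<bullet> f w)"

(* The Lie algebra is the tangent space at the identity, identified with the model space 'a by
   the differential of a chart c around 0; the inner product of 'a thereby is the chosen inner
   product on the Lie algebra (any inner product arises so, after a linear change of chart).
   Below, pi X is the differential at 0 of the representation rho in the direction X. *)
definition differential :: "('g::zero, 'a::real_normed_vector) chart \<Rightarrow>
    ('g \<Rightarrow> 'v::real_normed_vector \<Rightarrow> 'v) \<Rightarrow> 'a \<Rightarrow> 'v \<Rightarrow> 'v" where
  "differential c \<rho> X v = frechet_derivative (\<lambda>x. \<rho> (chart_inv c x) v) (at (snd c 0)) X"

definition moment_map :: "('a::real_inner \<Rightarrow> 'v::real_inner \<Rightarrow> 'v) \<Rightarrow> 'v \<Rightarrow> 'a" where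
  "moment_map \<pi> v = (THE m. \<forall>X. m \<bullet> X = (\<pi> X v \<bullet> v) / (norm v)\<^sup>2)"

definition weight_space :: "('a::real_inner \<Rightarrow> 'v::real_inner \<Rightarrow> 'v) \<Rightarrow> 'a \<Rightarrow> 'v set" where
  "weight_space \<pi> \<alpha> = {v. \<forall>X. \<pi> X v = (X \<bullet> \<alpha>) *\<^sub>R v}"

definition weights :: "('a::real_inner \<Rightarrow> 'v::real_inner \<Rightarrow> 'v) \<Rightarrow> 'a set" where
  "weights \<pi> = {\<alpha>. weight_space \<pi> \<alpha> \<noteq> {0}}"

(* The family of components of v; for a non-weight alpha the membership condition forces
   c alpha = 0. *)
definition weight_component :: "('a::real_inner \<Rightarrow> 'v::real_inner \<Rightarrow> 'v) \<Rightarrow> 'v \<Rightarrow> 'a \<Rightarrow> 'v" where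
  "weight_component \<pi> v =
     (THE c. (\<forall>\<alpha>. c \<alpha> \<in> weight_space \<pi> \<alpha>) \<and> v = (\<Sum>\<alpha>\<in>weights \<pi>. c \<alpha>))"

definition weight_support :: "('a::real_inner \<Rightarrow> 'v::real_inner \<Rightarrow> 'v) \<Rightarrow> 'v \<Rightarrow> 'a set" where
  "weight_support \<pi> v = {\<alpha> \<in> weights \<pi>. weight_component \<pi> v \<alpha> \<noteq> 0}"

end

theory Submission
  imports Defs
begin

text \<open>
The operators \<open>\<rho> g\<close> commute and are symmetric, so they have a common orthonormal eigenbasis \<open>E\<close>
(\<open>commuting_symmetric_ops_joint_eigenbasis\<close>). The eigenvalues along \<open>e \<in> E\<close> form a continuous character of
the connected group, hence a positive one, and its logarithm is an additive function whose
derivative at the identity is \<open>X \<mapsto> X \<bullet> \<alpha> e\<close> for a weight \<open>\<alpha> e\<close>. In these coordinates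
\<open>\<pi> X\<close> is diagonal with entries \<open>X \<bullet> \<alpha> e\<close>.

The exponential map of the group would show that the orbit of \<open>v\<close> consists of the vectors
\<open>\<Sum>e\<in>E. exp (X \<bullet> \<alpha> e) * (v \<bullet> e) *\<^sub>R e\<close>. The proof obtains this without an exponential map: an additive
map from a connected abelian Lie group to a Euclidean space has the same range as its derivative at the
identity (\<open>range_additive_eq_range_derivative\<close>). Applied to the vector of all logarithms of
eigenvalues, this describes the orbit.

The moment map sends a vector to the mean of the weights \<open>\<alpha> e\<close> with respect to the squares of its
coordinates. On the orbit these are the means of the weights in the support of \<open>v\<close> with
coefficients proportional to \<open>(v \<bullet> e)\<^sup>2 * exp (2 * (X \<bullet> \<alpha> e))\<close>. That such means exhaust exactly the relative
interior of the convex hull is \<open>rel_interior_convex_hull_eq_exponential_means\<close>: positive coefficients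
keep them off the relative boundary, and a point of the relative interior is attained because a
convex, coercive sum of exponentials has a minimum.
\<close>

section \<open>Linear algebra in real inner product spaces\<close>

text \<open>The quotient is \<open>0\<close> at a vector \<open>c = 0\<close>, so \<open>C\<close> may contain the zero vector; this is the form in
which Gram-Schmidt delivers an orthogonal spanning set.\<close>

lemma orthogonal_expansion:
  fixes C :: "'a::real_inner set"
  assumes "finite C" and "pairwise orthogonal C" and "x \<in> span C"
  shows "x = (\<Sum>c\<in>C. ((x \<bullet> c) / (c \<bullet> c)) *\<^sub>R c)"
proof -
  have "linear (\<lambda>x. \<Sum>c\<in>C. ((x \<bullet> c) / (c \<bullet> c)) *\<^sub>R c)"
    by (intro linear_compose_sum ballI)
      (auto simp: linear_iff inner_add_left add_divide_distrib scaleR_add_left)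
  moreover have "b = (\<Sum>c\<in>C. ((b \<bullet> c) / (c \<bullet> c)) *\<^sub>R c)" if "b \<in> C" for b
  proof -
    have "(\<Sum>c\<in>C. ((b \<bullet> c) / (c \<bullet> c)) *\<^sub>R c) = (\<Sum>c\<in>C. if c = b then b else 0)"
      using assms(2) that
      by (intro sum.cong) (auto simp: pairwise_def orthogonal_def)
    then show ?thesis using assms(1) that by simp
  qed
  ultimately show ?thesis
    using linear_eq_on_span[of id "\<lambda>x. \<Sum>c\<in>C. ((x \<bullet> c) / (c \<bullet> c)) *\<^sub>R c" C x] assms(3)
    by (simp add: linear_id[unfolded id_def] id_def)
qed

lemma orthonormal_expansion:
  fixes E :: "'a::real_inner set"
  assumes "finite E" and "pairwise orthogonal E" and "\<And>e. e \<in> E \<Longrightarrow> norm e = 1" and "x \<in> span E"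
  shows "x = (\<Sum>e\<in>E. (x \<bullet> e) *\<^sub>R e)"
proof -
  have "x = (\<Sum>e\<in>E. ((x \<bullet> e) / (e \<bullet> e)) *\<^sub>R e)"
    by (rule orthogonal_expansion[OF assms(1,2,4)])
  also have "\<dots> = (\<Sum>e\<in>E. (x \<bullet> e) *\<^sub>R e)"
    using assms(3) by (intro sum.cong) (auto simp: dot_square_norm)
  finally show ?thesis .
qed

text \<open>A Heine-Borel property for the finite-dimensional subspaces of an inner product space. It provides the minima used on the span of the differences of the
weights, which live in a model space that is not of class \<open>euclidean_space\<close>. By Cauchy-Schwarz the
coordinates of a vector of the ball with respect to an orthogonal spanning set are bounded, so the
ball is a closed subset of a finite sum of compact segments.\<close>

lemma compact_cball_Int_span:
  fixes B :: "'a::real_inner set"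
  assumes "finite B"
  shows "compact (cball 0 r \<inter> span B)"
proof -
  obtain C where C: "finite C" "span C = span B" "pairwise orthogonal C"
    using basis_orthogonal[OF assms] by blast
  define Q where "Q = (\<lambda>D :: 'a set. {\<Sum>c\<in>D. t c *\<^sub>R c | t. \<forall>c\<in>D. \<bar>t c\<bar> * norm c \<le> r})"
  have "compact (Q D)" if "finite D" for D
    using that
  proof (induction D)
    case empty
    then show ?case by (simp add: Q_def)
  next
    case (insert b D)
    define J where "J = (\<lambda>s::real. s *\<^sub>R b) ` {s. \<bar>s\<bar> * norm b \<le> r}"
    have "compact J"
    proof (cases "b = 0")
      case True
      then have "J = {} \<or> J = {0}" by (auto simp: J_def)
      then show ?thesis by auto
    next
      case False
      then have "{s. \<bar>s\<bar> * norm b \<le> r} = {s. \<bar>s\<bar> \<le> r / norm b}"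
        by (simp add: pos_le_divide_eq)
      also have "\<dots> = cbox (- (r / norm b)) (r / norm b)"
        by (auto simp: abs_le_iff)
      finally have "{s. \<bar>s\<bar> * norm b \<le> r} = cbox (- (r / norm b)) (r / norm b)" .
      then show ?thesis
        unfolding J_def by (auto intro!: compact_continuous_image continuous_intros)
    qed
    moreover have "Q (insert b D) = {x + y | x y. x \<in> J \<and> y \<in> Q D}"
    proof (intro equalityI subsetI)
      fix z assume "z \<in> Q (insert b D)"
      then show "z \<in> {x + y | x y. x \<in> J \<and> y \<in> Q D}"
        using insert.hyps by (auto simp: Q_def J_def)
    next
      fix z assume "z \<in> {x + y | x y. x \<in> J \<and> y \<in> Q D}"
      then obtain s t where st: "z = s *\<^sub>R b + (\<Sum>c\<in>D. t c *\<^sub>R c)"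
          "\<bar>s\<bar> * norm b \<le> r" "\<forall>c\<in>D. \<bar>t c\<bar> * norm c \<le> r"
        by (auto simp: Q_def J_def)
      have "(\<Sum>c\<in>D. (t(b := s)) c *\<^sub>R c) = (\<Sum>c\<in>D. t c *\<^sub>R c)"
        using insert.hyps by (intro sum.cong) auto
      then have "z = (\<Sum>c\<in>insert b D. (t(b := s)) c *\<^sub>R c)"
        using insert.hyps st by simp
      then show "z \<in> Q (insert b D)"
        using st unfolding Q_def by (intro CollectI exI[of _ "t(b := s)"]) auto
    qed
    ultimately show ?case using compact_sums insert.IH by simp
  qed
  moreover have "closed (cball 0 r \<inter> span B)"
  proof -
    have "x \<in> span C \<longleftrightarrow> x = (\<Sum>c\<in>C. ((x \<bullet> c) / (c \<bullet> c)) *\<^sub>R c)" for x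
      using orthogonal_expansion[OF C(1,3)]
      by (metis (no_types, lifting) span_base span_scale span_sum)
    then have "span C = {x. x = (\<Sum>c\<in>C. ((x \<bullet> c) / (c \<bullet> c)) *\<^sub>R c)}" by blast
    moreover have "closed {x. x = (\<Sum>c\<in>C. ((x \<bullet> c) / (c \<bullet> c)) *\<^sub>R c)}"
      unfolding divide_inverse by (intro closed_Collect_eq continuous_intros)
    ultimately show ?thesis using C(2) by auto
  qed
  moreover have "cball 0 r \<inter> span B \<subseteq> Q C"
  proof
    fix x assume x: "x \<in> cball 0 r \<inter> span B"
    have "\<bar>(x \<bullet> c) / (c \<bullet> c)\<bar> * norm c \<le> r" for c
    proof (cases "c = 0")
      case False
      have "\<bar>x \<bullet> c\<bar> \<le> norm x * norm c" by (rule Cauchy_Schwarz_ineq2)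
      also have "\<dots> \<le> r * norm c" using x by (simp add: mult_right_mono)
      finally show ?thesis
        using False by (simp add: dot_square_norm power2_eq_square field_simps)
    next
      case True
      have "0 \<le> r" using x by (auto intro: order_trans[OF norm_ge_zero])
      then show ?thesis using True by simp
    qed
    then show "x \<in> Q C"
      using orthogonal_expansion[OF C(1,3), of x] x C(2) unfolding Q_def by auto
  qed
  ultimately show ?thesis
    using C(1) by (metis Int_absorb1 compact_Int_closed)
qed

text \<open>The vectors representing the derivatives of the characters of the group will be the weights.\<close>

lemma riesz_representation_finite_dim:
  fixes L :: "'a::real_inner \<Rightarrow> real"
  assumes "finite B" and "span B = (UNIV :: 'a set)" and "linear L"
  shows "\<exists>\<alpha>. \<forall>X. L X = X \<bullet> \<alpha>"
proof -
  obtain C :: "'a set" where C: "finite C" "span C = UNIV" "pairwise orthogonal C"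
    using basis_orthogonal[OF assms(1)] unfolding assms(2) by blast
  have "L X = X \<bullet> (\<Sum>c\<in>C. (L c / (c \<bullet> c)) *\<^sub>R c)" for X
  proof -
    have "L X = L (\<Sum>c\<in>C. ((X \<bullet> c) / (c \<bullet> c)) *\<^sub>R c)"
      using orthogonal_expansion[OF C(1,3), of X] C(2) by simp
    also have "\<dots> = (\<Sum>c\<in>C. ((X \<bullet> c) / (c \<bullet> c)) * L c)"
      using assms(3) by (simp add: linear_sum linear_cmul)
    finally show ?thesis by (simp add: inner_sum_right mult.commute)
  qed
  then show ?thesis by blast
qed

lemma quadratic_nonneg_imp_linear_coeff_zero:
  fixes a b :: real
  assumes "\<And>t. 0 \<le> b * t + a * t\<^sup>2"
  shows "b = 0"
proof -
  have "((\<lambda>t. b * t + a * t\<^sup>2) has_real_derivative b) (at 0)"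
    by (auto intro!: derivative_eq_intros)
  then show ?thesis
    by (rule DERIV_local_min[where d = 1]) (use assms in auto)
qed

text \<open>The Rayleigh quotient: a maximiser \<open>x\<close> of \<open>f y \<bullet> y\<close> on the unit sphere of \<open>S\<close> is an eigenvector. With
\<open>\<mu>\<close> the maximum, the quadratic form \<open>\<mu> (y \<bullet> y) - f y \<bullet> y\<close> is nonnegative on \<open>S\<close> and vanishes at \<open>x\<close>, hence its
first variation at \<open>x\<close> vanishes; evaluated in the direction \<open>\<mu> x - f x\<close> this is twice the square of the norm
of that vector.\<close>

lemma symmetric_op_has_eigenvector:
  fixes f :: "'v::euclidean_space \<Rightarrow> 'v"
  assumes f: "linear f" "symmetric_op f"
    and S: "subspace S" "S \<noteq> {0}" "f ` S \<subseteq> S"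
  shows "\<exists>x\<in>S. x \<noteq> 0 \<and> (\<exists>\<mu>. f x = \<mu> *\<^sub>R x)"
proof -
  define K where "K = sphere 0 1 \<inter> S"
  have "compact K"
    unfolding K_def using S(1) by (intro compact_Int_closed closed_subspace) auto
  moreover have "K \<noteq> {}"
  proof -
    obtain s where "s \<in> S" "s \<noteq> 0" using S(1,2) subspace_0 by blast
    then have "s /\<^sub>R norm s \<in> K" using S(1) by (simp add: K_def subspace_scale)
    then show ?thesis by blast
  qed
  moreover have "continuous_on K (\<lambda>x. f x \<bullet> x)"
    by (intro continuous_intros linear_continuous_on_compose[OF _ f(1)])
  ultimately obtain x where x: "x \<in> K" "\<forall>y\<in>K. f y \<bullet> y \<le> f x \<bullet> x"
    using continuous_attains_sup by blast
  define \<mu> where "\<mu> = f x \<bullet> x"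
  have bound: "f y \<bullet> y \<le> \<mu> * (y \<bullet> y)" if "y \<in> S" for y
  proof (cases "y = 0")
    case False
    then have "y /\<^sub>R norm y \<in> K" using S(1) that by (simp add: K_def subspace_scale)
    then have "f (y /\<^sub>R norm y) \<bullet> (y /\<^sub>R norm y) \<le> \<mu>" using x(2) \<mu>_def by blast
    then show ?thesis
      using False f(1)
      by (simp add: linear_cmul dot_square_norm power2_eq_square field_simps)
  qed (simp add: linear_0[OF f(1)])
  have xS: "x \<in> S" "x \<bullet> x = 1" using x(1) by (auto simp: K_def dot_square_norm)
  define u where "u = \<mu> *\<^sub>R x - f x"
  have uS: "u \<in> S"
    unfolding u_def using S xS by (auto intro!: subspace_diff subspace_scale)
  have "0 \<le> (2 * (u \<bullet> u)) * t + (\<mu> * (u \<bullet> u) - f u \<bullet> u) * t\<^sup>2" for t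
  proof -
    have "f u \<bullet> x = f x \<bullet> u"
      using f(2) by (simp add: symmetric_op_def inner_commute)
    then have "\<mu> * ((x + t *\<^sub>R u) \<bullet> (x + t *\<^sub>R u)) - f (x + t *\<^sub>R u) \<bullet> (x + t *\<^sub>R u)
        = (2 * (u \<bullet> u)) * t + (\<mu> * (u \<bullet> u) - f u \<bullet> u) * t\<^sup>2"
    proof -
      have 1: "u \<bullet> u = \<mu> * (x \<bullet> u) - f x \<bullet> u"
        by (subst (1) u_def) (simp add: inner_diff_left)
      have 2: "f x \<bullet> x = \<mu> * (x \<bullet> x)" using xS by (simp add: \<mu>_def)
      have "\<mu> * ((x + t *\<^sub>R u) \<bullet> (x + t *\<^sub>R u)) - f (x + t *\<^sub>R u) \<bullet> (x + t *\<^sub>R u)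
        = (\<mu> * (x \<bullet> x) - f x \<bullet> x) + 2 * t * (\<mu> * (x \<bullet> u) - f x \<bullet> u)
          + t\<^sup>2 * (\<mu> * (u \<bullet> u) - f u \<bullet> u)"
        using \<open>f u \<bullet> x = f x \<bullet> u\<close> f(1)
        by (simp add: linear_add linear_cmul inner_add_left inner_add_right inner_commute[of u x]
            power2_eq_square algebra_simps)
      then show ?thesis unfolding 1[symmetric] 2 by (simp add: algebra_simps)
    qed
    moreover have "x + t *\<^sub>R u \<in> S"
      using S(1) xS uS by (simp add: subspace_add subspace_scale)
    ultimately show ?thesis using bound by fastforce
  qed
  then have "2 * (u \<bullet> u) = 0" by (rule quadratic_nonneg_imp_linear_coeff_zero)
  then have "f x = \<mu> *\<^sub>R x" by (simp add: u_def)
  moreover have "x \<noteq> 0" using xS(2) by auto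
  ultimately show ?thesis using xS(1) by blast
qed

text \<open>Induction on the dimension. If some operator is not scalar on \<open>S\<close>, one of its eigenspaces in \<open>S\<close> is
proper and nonzero. It is invariant under the family by commutativity, its orthogonal complement by
symmetry, and both have smaller dimension.\<close>

lemma commuting_symmetric_ops_joint_eigenbasis_subspace:
  fixes f :: "'i \<Rightarrow> 'v::euclidean_space \<Rightarrow> 'v"
  assumes f: "\<And>g. linear (f g)" "\<And>g. symmetric_op (f g)"
    and comm: "\<And>g h x. f g (f h x) = f h (f g x)"
    and S: "subspace S" "\<And>g. f g ` S \<subseteq> S"
  shows "\<exists>B. finite B \<and> 0 \<notin> B \<and> pairwise orthogonal B \<and> span B = S \<and>
    (\<forall>b\<in>B. \<forall>g. \<exists>\<mu>. f g b = \<mu> *\<^sub>R b)"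
  using S
proof (induction "dim S" arbitrary: S rule: less_induct)
  case less
  show ?case
  proof (cases "\<forall>g. \<exists>\<mu>. \<forall>x\<in>S. f g x = \<mu> *\<^sub>R x")
    case True
    obtain B where "0 \<notin> B" "B \<subseteq> S" "pairwise orthogonal B" "independent B" "span B = S"
      using orthogonal_basis_subspace[OF less.prems(1)] by metis
    then show ?thesis
      using True by (intro exI[of _ B]) (use independent_imp_finite in blast)
  next
    case False
    then obtain g where g: "\<nexists>\<mu>. \<forall>x\<in>S. f g x = \<mu> *\<^sub>R x" by blast
    then have "S \<noteq> {0}" by (auto simp: linear_0[OF f(1)])
    then obtain x \<mu> where x: "x \<in> S" "x \<noteq> 0" "f g x = \<mu> *\<^sub>R x"
      using symmetric_op_has_eigenvector[OF f less.prems(1) _ less.prems(2)] by blast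
    define U where "U = {y\<in>S. f g y = \<mu> *\<^sub>R y}"
    define U' where "U' = {y\<in>S. \<forall>u\<in>U. y \<bullet> u = 0}"
    have sub: "subspace U" "subspace U'"
      using less.prems(1) f(1)
      by (auto simp: U_def U'_def subspace_def linear_0 linear_add linear_cmul inner_add_left
          algebra_simps)
    have invU: "f h ` U \<subseteq> U" for h
    proof -
      have "f g (f h y) = \<mu> *\<^sub>R f h y" if "f g y = \<mu> *\<^sub>R y" for y
        using comm[of g h y] that f(1) by (simp add: linear_cmul)
      then show ?thesis using less.prems(2)[of h] by (auto simp: U_def)
    qed
    have invU': "f h ` U' \<subseteq> U'" for h
      using less.prems(2)[of h] f(2)[of h] invU[of h] by (auto simp: U'_def symmetric_op_def)
    have "U \<subset> S" using g by (auto simp: U_def)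
    moreover have "U' \<subset> S"
    proof -
      have "x \<in> U" using x by (simp add: U_def)
      then have "x \<notin> U'" using x(2) by (auto simp: U'_def intro!: bexI[of _ x])
      then show ?thesis using x(1) by (auto simp: U'_def)
    qed
    ultimately have "dim U < dim S" "dim U' < dim S"
      using sub less.prems(1) by (metis dim_psubset span_eq_iff)+
    note dims = this
    obtain B where B: "finite B" "0 \<notin> B" "pairwise orthogonal B" "span B = U"
        "\<forall>b\<in>B. \<forall>g. \<exists>\<mu>. f g b = \<mu> *\<^sub>R b"
      using less.hyps[OF dims(1) sub(1) invU] by blast
    obtain B' where B': "finite B'" "0 \<notin> B'" "pairwise orthogonal B'" "span B' = U'"
        "\<forall>b\<in>B'. \<forall>g. \<exists>\<mu>. f g b = \<mu> *\<^sub>R b"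
      using less.hyps[OF dims(2) sub(2) invU'] by blast
    have "B \<subseteq> U" "B' \<subseteq> U'" using B(4) B'(4) span_superset by blast+
    then have "orthogonal b b' \<and> orthogonal b' b" if "b \<in> B" "b' \<in> B'" for b b'
      using that by (auto simp: U'_def orthogonal_def inner_commute)
    then have "pairwise orthogonal (B \<union> B')"
      using B(3) B'(3) by (auto simp: pairwise_def)
    moreover have "span (B \<union> B') = S"
    proof
      show "span (B \<union> B') \<subseteq> S"
        using \<open>B \<subseteq> U\<close> \<open>B' \<subseteq> U'\<close> less.prems(1)
        by (intro span_minimal) (auto simp: U_def U'_def)
      show "S \<subseteq> span (B \<union> B')"
      proof
        fix s assume s: "s \<in> S"
        obtain y z where yz: "y \<in> span U" "\<And>w. w \<in> span U \<Longrightarrow> orthogonal z w" "s = y + z"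
          using orthogonal_subspace_decomp_exists[of U s] by metis
        have y: "y \<in> U" using yz(1) sub(1) by (metis span_eq_iff)
        have "z = s - y" using yz(3) by simp
        then have "z \<in> S" using y s less.prems(1) by (simp add: U_def subspace_diff)
        then have "z \<in> U'"
          using yz(2) by (auto simp: U'_def orthogonal_def span_base)
        then show "s \<in> span (B \<union> B')"
          using y B(4) B'(4) yz(3) by (metis span_add span_mono sup_ge1 sup_ge2 subsetD)
      qed
    qed
    ultimately show ?thesis
      using B B' by (intro exI[of _ "B \<union> B'"]) blast
  qed
qed

lemma commuting_symmetric_ops_joint_eigenbasis:
  fixes f :: "'i \<Rightarrow> 'v::euclidean_space \<Rightarrow> 'v"
  assumes f: "\<And>g. linear (f g)" "\<And>g. symmetric_op (f g)"
    and comm: "\<And>g h x. f g (f h x) = f h (f g x)"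
  obtains E where "finite E" "pairwise orthogonal E" "\<And>e. e \<in> E \<Longrightarrow> norm e = 1"
    "span E = UNIV" "\<And>e g. e \<in> E \<Longrightarrow> \<exists>\<mu>. f g e = \<mu> *\<^sub>R e"
proof -
  have "\<exists>B. finite B \<and> 0 \<notin> B \<and> pairwise orthogonal B \<and> span B = UNIV \<and>
      (\<forall>b\<in>B. \<forall>g. \<exists>\<mu>. f g b = \<mu> *\<^sub>R b)"
    by (rule commuting_symmetric_ops_joint_eigenbasis_subspace[where f = f, OF f comm]) auto
  then obtain B where B: "finite B" "0 \<notin> B" "pairwise orthogonal B" "span B = UNIV"
      "\<forall>b\<in>B. \<forall>g. \<exists>\<mu>. f g b = \<mu> *\<^sub>R b"
    by blast
  define E where "E = (\<lambda>b. b /\<^sub>R norm b) ` B"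
  have "pairwise orthogonal E"
    using B(3) by (auto simp: E_def pairwise_def orthogonal_def) 
  moreover have "span E = UNIV"
  proof -
    have "b \<in> span E" if "b \<in> B" for b
    proof -
      have "norm b *\<^sub>R (b /\<^sub>R norm b) \<in> span E"
        using that by (intro span_scale span_base) (simp add: E_def)
      then show ?thesis using B(2) that by (cases "b = 0") auto
    qed
    then have "span B \<subseteq> span E" by (intro span_minimal) auto
    then show ?thesis using B(4) by blast
  qed
  moreover have "\<exists>\<mu>. f g e = \<mu> *\<^sub>R e" if e: "e \<in> E" for e g
  proof -
    obtain b \<mu> where "b \<in> B" "e = b /\<^sub>R norm b" "f g b = \<mu> *\<^sub>R b"
      using e B(5) unfolding E_def by blast
    then have "f g e = \<mu> *\<^sub>R e" using f(1) by (simp add: linear_cmul)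
    then show ?thesis by blast
  qed
  moreover have "finite E" using B(1) by (simp add: E_def)
  moreover have "norm e = 1" if e: "e \<in> E" for e
  proof -
    obtain b where "b \<in> B" "e = b /\<^sub>R norm b" using e unfolding E_def by blast
    moreover from this have "b \<noteq> 0" using B(2) by blast
    ultimately show ?thesis by simp
  qed
  ultimately show thesis by (intro that[of E])
qed

section \<open>The relative interior of a polytope as a set of exponential means\<close>

text \<open>Compactness of the unit sphere turns pointwise positivity of the support function
\<open>X \<mapsto> max\<^sub>i (X \<bullet> \<beta> i)\<close> into a linear lower bound. The bound gives both the coercivity of exponential
sums and the stability of the positivity condition under small translations of the \<open>\<beta> i\<close>.\<close>

lemma positive_spread_imp_uniform:
  fixes \<beta> :: "'i \<Rightarrow> 'a::real_inner"
  assumes "finite B" and I: "finite I" "I \<noteq> {}"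
    and pos: "\<And>X. X \<in> span B \<Longrightarrow> X \<noteq> 0 \<Longrightarrow> \<exists>i\<in>I. X \<bullet> \<beta> i > 0"
  shows "\<exists>\<delta>>0. \<forall>X\<in>span B. \<exists>i\<in>I. \<delta> * norm X \<le> X \<bullet> \<beta> i"
proof -
  define K where "K = sphere 0 1 \<inter> span B"
  \<comment> \<open>A continuous substitute for the maximum over \<open>I\<close>, at most \<open>card I\<close> times as large where it is positive.\<close>
  define s where "s = (\<lambda>X. \<Sum>i\<in>I. max 0 (X \<bullet> \<beta> i))"
  have "compact K"
  proof -
    have "K = (cball 0 1 \<inter> span B) \<inter> {X. norm X = 1}" by (auto simp: K_def)
    moreover have "closed {X::'a. norm X = 1}" by (intro closed_Collect_eq continuous_intros)
    ultimately show ?thesis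
      using compact_Int_closed[OF compact_cball_Int_span[OF assms(1)]] by metis
  qed
  have s_pos: "s X > 0" if X: "X \<in> K" for X
  proof -
    have "X \<in> span B" "X \<noteq> 0" using X by (auto simp: K_def)
    then obtain i where "i \<in> I" "X \<bullet> \<beta> i > 0"
      using pos by blast
    then show ?thesis
      unfolding s_def using I(1) by (intro sum_pos2[of I i]) auto
  qed
  obtain m where m: "m > 0" "\<And>X. X \<in> K \<Longrightarrow> m \<le> s X"
  proof (cases "K = {}")
    case False
    have "continuous_on K s" unfolding s_def by (intro continuous_intros)
    then obtain X where "X \<in> K" "\<forall>Y\<in>K. s X \<le> s Y"
      using continuous_attains_inf[OF \<open>compact K\<close> False] by blast
    then show ?thesis using that[of "s X"] s_pos by blast
  qed (use that[of 1] in auto)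
  define \<delta> where "\<delta> = m / card I"
  have cI: "card I > 0" using I by (simp add: card_gt_0_iff)
  have "\<exists>i\<in>I. \<delta> * norm X \<le> X \<bullet> \<beta> i" if X: "X \<in> span B" for X
  proof (cases "X = 0")
    case False
    then have XK: "X /\<^sub>R norm X \<in> K" using X by (simp add: K_def span_scale)
    have "\<exists>i\<in>I. \<delta> \<le> (X /\<^sub>R norm X) \<bullet> \<beta> i"
    proof (rule ccontr)
      assume "\<not> ?thesis"
      then have "\<And>i. i \<in> I \<Longrightarrow> max 0 ((X /\<^sub>R norm X) \<bullet> \<beta> i) < \<delta>"
        using m(1) cI by (auto simp: \<delta>_def not_le)
      then have "s (X /\<^sub>R norm X) < card I * \<delta>"
        unfolding s_def using I by (intro sum_bounded_above_strict) (auto simp: card_gt_0_iff)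
      then show False using m(2)[OF XK] cI by (simp add: \<delta>_def)
    qed
    then show ?thesis using False by (simp add: field_simps)
  qed (use I in auto)
  moreover have "\<delta> > 0" using m(1) cI by (simp add: \<delta>_def)
  ultimately show ?thesis by blast
qed

text \<open>The gradient of \<open>F X = \<Sum>i\<in>I. p i * exp (X \<bullet> \<beta> i)\<close> is the displayed sum, and \<open>F\<close> has a minimum on the span of \<open>B\<close>
because the hypothesis makes it grow at least linearly there.\<close>

lemma exponential_sum_has_critical_point:
  fixes \<beta> :: "'i \<Rightarrow> 'a::real_inner"
  assumes "finite B" and I: "finite I" "I \<noteq> {}" and p: "\<And>i. i \<in> I \<Longrightarrow> p i > 0"
    and pos: "\<And>X. X \<in> span B \<Longrightarrow> X \<noteq> 0 \<Longrightarrow> \<exists>i\<in>I. X \<bullet> \<beta> i > 0"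
  shows "\<exists>X. \<forall>Z\<in>span B. Z \<bullet> (\<Sum>i\<in>I. (p i * exp (X \<bullet> \<beta> i)) *\<^sub>R \<beta> i) = 0"
proof -
  define F where "F = (\<lambda>X. \<Sum>i\<in>I. p i * exp (X \<bullet> \<beta> i))"
  obtain \<delta> where \<delta>: "\<delta> > 0" "\<And>X. X \<in> span B \<Longrightarrow> \<exists>i\<in>I. \<delta> * norm X \<le> X \<bullet> \<beta> i"
    using positive_spread_imp_uniform[OF assms(1) I pos] by auto
  define q where "q = Min (p ` I)"
  have q: "q > 0" "\<And>i. i \<in> I \<Longrightarrow> q \<le> p i" using I p by (auto simp: q_def)
  have coercive: "q * (\<delta> * norm X) \<le> F X" if X: "X \<in> span B" for X
  proof -
    obtain i where i: "i \<in> I" "\<delta> * norm X \<le> X \<bullet> \<beta> i" using \<delta>(2) X by blast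
    have "\<delta> * norm X \<le> exp (X \<bullet> \<beta> i)"
      using i(2) exp_ge_add_one_self[of "X \<bullet> \<beta> i"] by linarith
    then have "q * (\<delta> * norm X) \<le> p i * exp (X \<bullet> \<beta> i)"
      using q i(1) \<delta>(1) by (intro mult_mono) (auto intro: less_imp_le[OF p])
    also have "\<dots> \<le> F X"
      unfolding F_def using i(1) I(1) p
      by (intro member_le_sum[of i I "\<lambda>i. p i * exp (X \<bullet> \<beta> i)"]) (auto simp: less_imp_le)
    finally show ?thesis .
  qed
  define R where "R = F 0 / (q * \<delta>)"
  have "0 \<le> R"
    unfolding R_def F_def using q(1) \<delta>(1) p
    by (intro divide_nonneg_pos sum_nonneg) (auto simp: less_imp_le)
  have "continuous_on (cball 0 R \<inter> span B) F"
    unfolding F_def by (intro continuous_intros)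
  then obtain X where X: "X \<in> cball 0 R \<inter> span B" "\<forall>Y\<in>cball 0 R \<inter> span B. F X \<le> F Y"
    using continuous_attains_inf[OF compact_cball_Int_span[OF assms(1)]] \<open>0 \<le> R\<close>
    by (metis Int_iff centre_in_cball empty_iff span_zero)
  have minimal: "F X \<le> F Y" if "Y \<in> span B" for Y
  proof (cases "norm Y \<le> R")
    case False
    have "F X \<le> F 0" using X(2) \<open>0 \<le> R\<close> by (simp add: span_zero)
    also have "F 0 = q * (\<delta> * R)" using q(1) \<delta>(1) by (simp add: R_def)
    also have "\<dots> \<le> q * (\<delta> * norm Y)" using False q(1) \<delta>(1) by simp
    also have "\<dots> \<le> F Y" by (rule coercive[OF that])
    finally show ?thesis .
  qed (use X(2) that in auto)
  have "Z \<bullet> (\<Sum>i\<in>I. (p i * exp (X \<bullet> \<beta> i)) *\<^sub>R \<beta> i) = 0" if Z: "Z \<in> span B" for Z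
  proof -
    have "((\<lambda>t. F (X + t *\<^sub>R Z)) has_real_derivative
        (\<Sum>i\<in>I. p i * exp (X \<bullet> \<beta> i) * (Z \<bullet> \<beta> i))) (at 0)"
      unfolding F_def inner_add_left inner_scaleR_left
      by (auto intro!: derivative_eq_intros sum.cong)
    then have "(\<Sum>i\<in>I. p i * exp (X \<bullet> \<beta> i) * (Z \<bullet> \<beta> i)) = 0"
      by (rule DERIV_local_min[where d = 1])
        (use minimal X(1) Z in \<open>auto simp: span_add span_scale\<close>)
    then show ?thesis by (simp add: inner_sum_right)
  qed
  then show ?thesis by blast
qed

text \<open>The mean \<open>M X\<close> is the gradient at \<open>X\<close> of the convex function \<open>X \<mapsto> ln (\<Sum>i\<in>I. p i * exp (X \<bullet> \<alpha> i))\<close>. Let \<open>span B\<close> be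
the direction space of the affine hull of the \<open>\<alpha> i\<close>, and call \<open>y\<close> good if every nonzero direction in it
is strictly larger at some \<open>\<alpha> i\<close> than at \<open>y\<close>, that is, no supporting hyperplane passes through \<open>y\<close>. Every \<open>M X\<close>
is good because all its coefficients are positive. Conversely, for good \<open>y\<close> in the affine hull, a
critical point of \<open>\<Sum>i\<in>I. p i * exp (X \<bullet> (\<alpha> i - y))\<close> solves \<open>M X = y\<close>. Goodness is an open condition in the
affine hull, so means are relatively interior points of the hull, which contains them; and relatively
interior points are good, since they can be moved a little in any direction within the hull.\<close>

theorem rel_interior_convex_hull_eq_exponential_means:
  fixes \<alpha> :: "'i \<Rightarrow> 'a::real_inner"
  assumes I: "finite I" "I \<noteq> {}" and p: "\<And>i. i \<in> I \<Longrightarrow> p i > 0"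
  defines "M \<equiv> \<lambda>X. (1 / (\<Sum>i\<in>I. p i * exp (X \<bullet> \<alpha> i))) *\<^sub>R (\<Sum>i\<in>I. (p i * exp (X \<bullet> \<alpha> i)) *\<^sub>R \<alpha> i)"
  shows "range M = rel_interior (convex hull (\<alpha> ` I))"
proof -
  define B where "B = (\<lambda>(i, j). \<alpha> i - \<alpha> j) ` (I \<times> I)"
  define good where "good = (\<lambda>y. \<forall>X\<in>span B. X \<noteq> 0 \<longrightarrow> (\<exists>i\<in>I. X \<bullet> (\<alpha> i - y) > 0))"
  let ?A = "affine hull (\<alpha> ` I)"
  have B: "finite B" using I(1) by (simp add: B_def)
  obtain i0 where i0: "i0 \<in> I" using I(2) by blast
  have A_eq: "y \<in> ?A \<longleftrightarrow> y - \<alpha> i \<in> span B" if i: "i \<in> I" for y i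
  proof -
    have 1: "?A = (\<lambda>x. \<alpha> i + x) ` span ((\<lambda>x. - \<alpha> i + x) ` (\<alpha> ` I - {\<alpha> i}))"
      using i by (intro affine_hull_span2) auto
    have 2: "span ((\<lambda>x. - \<alpha> i + x) ` (\<alpha> ` I - {\<alpha> i})) = span B" (is "span ?D = _")
    proof
      show "span ?D \<subseteq> span B"
        using i by (intro span_mono) (auto simp: B_def)
      have D: "\<alpha> j - \<alpha> i \<in> span ?D" if "j \<in> I" for j
      proof (cases "\<alpha> j = \<alpha> i")
        case False
        then show ?thesis using that by (intro span_base) force
      qed (simp add: span_zero)
      have "\<alpha> j - \<alpha> k \<in> span ?D" if "j \<in> I" "k \<in> I" for j k
        using span_diff[OF D[OF that(1)] D[OF that(2)]] by simp
      then show "span B \<subseteq> span ?D"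
        by (intro span_minimal) (auto simp: B_def)
    qed
    show ?thesis unfolding 1 2 by (force simp: image_iff)
  qed
  have diff_A: "y - z \<in> span B" if "y \<in> ?A" "z \<in> ?A" for y z
  proof -
    have "(y - \<alpha> i0) - (z - \<alpha> i0) \<in> span B"
      using that unfolding A_eq[OF i0] by (rule span_diff)
    then show ?thesis by simp
  qed
  have \<alpha>A: "\<alpha> i \<in> ?A" if "i \<in> I" for i using that by (simp add: hull_inc)
  have N_pos: "(\<Sum>i\<in>I. p i * exp (X \<bullet> \<alpha> i)) > 0" for X
    using I p by (intro sum_pos) auto
  have M_conv: "\<exists>q. (\<forall>i\<in>I. q i > 0) \<and> sum q I = 1 \<and> M X = (\<Sum>i\<in>I. q i *\<^sub>R \<alpha> i)" for X
    using N_pos[of X] p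
    by (intro exI[of _ "\<lambda>i. p i * exp (X \<bullet> \<alpha> i) / (\<Sum>i\<in>I. p i * exp (X \<bullet> \<alpha> i))"])
      (auto simp: M_def scaleR_sum_right sum_divide_distrib[symmetric])
  have M_hull: "M X \<in> convex hull (\<alpha> ` I)" for X
  proof -
    obtain q where q: "\<forall>i\<in>I. q i > 0" "sum q I = 1" "M X = (\<Sum>i\<in>I. q i *\<^sub>R \<alpha> i)"
      using M_conv by blast
    show ?thesis
      unfolding q(3) using I q
      by (intro convex_sum) (auto simp: hull_inc less_imp_le)
  qed
  have M_good: "good (M X)" for X
    unfolding good_def
  proof (intro ballI impI, rule ccontr)
    fix Y assume Y: "Y \<in> span B" "Y \<noteq> 0" "\<not> (\<exists>i\<in>I. 0 < Y \<bullet> (\<alpha> i - M X))"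
    obtain q where q: "\<forall>i\<in>I. q i > 0" "sum q I = 1" "M X = (\<Sum>i\<in>I. q i *\<^sub>R \<alpha> i)"
      using M_conv by blast
    have "(\<Sum>i\<in>I. q i * (Y \<bullet> (M X - \<alpha> i))) = sum q I * (Y \<bullet> M X) - Y \<bullet> (\<Sum>i\<in>I. q i *\<^sub>R \<alpha> i)"
      by (simp add: inner_diff_right inner_sum_right sum_subtractf sum_distrib_right algebra_simps)
    then have "(\<Sum>i\<in>I. q i * (Y \<bullet> (M X - \<alpha> i))) = 0"
      using q(2,3) by simp
    moreover have "\<forall>i\<in>I. 0 \<le> q i * (Y \<bullet> (M X - \<alpha> i))"
      using Y(3) q(1) by (auto simp: inner_diff_right not_less less_imp_le intro!: mult_nonneg_nonneg)
    ultimately have "\<forall>i\<in>I. q i * (Y \<bullet> (M X - \<alpha> i)) = 0"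
      using I(1) by (simp add: sum_nonneg_eq_0_iff)
    then have const: "\<forall>i\<in>I. Y \<bullet> \<alpha> i = Y \<bullet> M X"
      using q(1) by (force simp: inner_diff_right)
    have "Y \<bullet> Z = 0" if "Z \<in> span B" for Z
      using that const
      by (induction rule: span_induct_alt) (auto simp: B_def inner_add_right inner_diff_right)
    then show False using Y(1,2) by force
  qed
  have good_M: "y \<in> range M" if y: "y \<in> ?A" "good y" for y
  proof -
    have pos: "\<exists>i\<in>I. X \<bullet> (\<alpha> i - y) > 0" if "X \<in> span B" "X \<noteq> 0" for X
      using y(2) that unfolding good_def by blast
    have "\<exists>X. \<forall>Z\<in>span B. Z \<bullet> (\<Sum>i\<in>I. (p i * exp (X \<bullet> (\<alpha> i - y))) *\<^sub>R (\<alpha> i - y)) = 0"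
      by (rule exponential_sum_has_critical_point[OF B I p pos])
    then obtain X where X:
      "\<forall>Z\<in>span B. Z \<bullet> (\<Sum>i\<in>I. (p i * exp (X \<bullet> (\<alpha> i - y))) *\<^sub>R (\<alpha> i - y)) = 0" ..
    define N where "N = (\<Sum>i\<in>I. p i * exp (X \<bullet> \<alpha> i))"
    let ?u = "\<Sum>i\<in>I. (p i * exp (X \<bullet> (\<alpha> i - y))) *\<^sub>R (\<alpha> i - y)"
    have "?u \<in> span B"
      using diff_A[OF \<alpha>A y(1)] by (intro span_sum span_scale) auto
    then have "?u = 0" using X by force
    moreover have "?u = exp (- (X \<bullet> y)) *\<^sub>R (\<Sum>i\<in>I. (p i * exp (X \<bullet> \<alpha> i)) *\<^sub>R (\<alpha> i - y))"
      by (simp add: scaleR_sum_right inner_diff_right exp_diff exp_minus divide_inverse ac_simps)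
    ultimately have "(\<Sum>i\<in>I. (p i * exp (X \<bullet> \<alpha> i)) *\<^sub>R (\<alpha> i - y)) = 0" by simp
    then have "(\<Sum>i\<in>I. (p i * exp (X \<bullet> \<alpha> i)) *\<^sub>R \<alpha> i) = N *\<^sub>R y"
      by (simp add: N_def scaleR_diff_right sum_subtractf scaleR_sum_left)
    then have "M X = y"
      using N_pos[of X] by (simp add: M_def N_def[symmetric])
    then show ?thesis by blast
  qed
  have "M X \<in> rel_interior (convex hull (\<alpha> ` I))" for X
  proof -
    have "\<exists>i\<in>I. Y \<bullet> (\<alpha> i - M X) > 0" if "Y \<in> span B" "Y \<noteq> 0" for Y
      using M_good[of X] that unfolding good_def by blast
    then have "\<exists>\<delta>>0. \<forall>Y\<in>span B. \<exists>i\<in>I. \<delta> * norm Y \<le> Y \<bullet> (\<alpha> i - M X)"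
      by (rule positive_spread_imp_uniform[OF B I])
    then obtain \<delta> where \<delta>: "\<delta> > 0"
      "\<And>Y. Y \<in> span B \<Longrightarrow> \<exists>i\<in>I. \<delta> * norm Y \<le> Y \<bullet> (\<alpha> i - M X)" by blast
    have "z \<in> convex hull (\<alpha> ` I)" if z: "z \<in> ball (M X) \<delta>" "z \<in> ?A" for z
    proof -
      have "good z"
        unfolding good_def
      proof (intro ballI impI)
        fix Y assume Y: "Y \<in> span B" "Y \<noteq> 0"
        obtain i where i: "i \<in> I" "\<delta> * norm Y \<le> Y \<bullet> (\<alpha> i - M X)" using \<delta>(2) Y(1) by blast
        have "Y \<bullet> (z - M X) \<le> norm Y * norm (z - M X)" by (rule norm_cauchy_schwarz)
        also have "\<dots> < norm Y * \<delta>" using z(1) Y(2) by (simp add: dist_norm norm_minus_commute)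
        finally show "\<exists>i\<in>I. 0 < Y \<bullet> (\<alpha> i - z)"
          using i by (intro bexI[of _ i]) (auto simp: inner_diff_right algebra_simps)
      qed
      then show ?thesis using good_M[OF z(2)] M_hull by blast
    qed
    then show ?thesis
      unfolding mem_rel_interior_ball using M_hull \<delta>(1) by (auto simp: affine_hull_convex_hull)
  qed
  moreover have "y \<in> range M" if y: "y \<in> rel_interior (convex hull (\<alpha> ` I))" for y
  proof -
    obtain \<epsilon> where e: "y \<in> convex hull (\<alpha> ` I)" "\<epsilon> > 0" "cball y \<epsilon> \<inter> ?A \<subseteq> convex hull (\<alpha> ` I)"
      using y by (auto simp: mem_rel_interior_cball affine_hull_convex_hull)
    have yA: "y \<in> ?A" using e(1) convex_hull_subset_affine_hull by blast
    have "good y"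
      unfolding good_def
    proof (intro ballI impI, rule ccontr)
      fix X assume X: "X \<in> span B" "X \<noteq> 0" "\<not> (\<exists>i\<in>I. 0 < X \<bullet> (\<alpha> i - y))"
      \<comment> \<open>Moving \<open>y\<close> by \<open>\<epsilon>\<close> in the direction \<open>X\<close> stays in the hull, but leaves the half-space containing it.\<close>
      define z where "z = y + (\<epsilon> / norm X) *\<^sub>R X"
      have "(y - \<alpha> i0) + (\<epsilon> / norm X) *\<^sub>R X \<in> span B"
        using yA X(1) A_eq[OF i0] by (intro span_add span_scale) auto
      then have "z \<in> ?A"
        by (simp add: A_eq[OF i0] z_def diff_add_eq)
      moreover have "z \<in> cball y \<epsilon>" using X(2) e(2) by (simp add: z_def dist_norm)
      ultimately have "z \<in> convex hull (\<alpha> ` I)" using e(3) by blast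
      moreover have "convex hull (\<alpha> ` I) \<subseteq> {w. X \<bullet> w \<le> X \<bullet> y}"
        using X(3) by (intro hull_minimal) (auto simp: inner_diff_right not_less convex_halfspace_le)
      ultimately have "(\<epsilon> / norm X) * (X \<bullet> X) \<le> 0" by (auto simp: z_def inner_add_right)
      moreover have "(\<epsilon> / norm X) * (X \<bullet> X) > 0" using X(2) e(2) by simp
      ultimately show False by linarith
    qed
    then show ?thesis using good_M yA by blast
  qed
  ultimately show ?thesis by blast
qed

section \<open>Additive maps on a connected abelian Lie group\<close>

lemma is_chart_facts:
  assumes "is_chart c"
  shows "open (fst c)" "open (chart_image c)"
    "x \<in> chart_image c \<Longrightarrow> chart_inv c x \<in> fst c"
    "x \<in> chart_image c \<Longrightarrow> snd c (chart_inv c x) = x"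
    "g \<in> fst c \<Longrightarrow> snd c g \<in> chart_image c"
    "g \<in> fst c \<Longrightarrow> chart_inv c (snd c g) = g"
    "continuous_on (fst c) (snd c)" "continuous_on (chart_image c) (chart_inv c)"
proof -
  have h: "homeomorphism (fst c) (chart_image c) (snd c) (chart_inv c)"
    and o: "open (fst c)" "open (chart_image c)"
    using assms by (auto simp: is_chart_def)
  show "open (fst c)" "open (chart_image c)" by (rule o)+
  show "x \<in> chart_image c \<Longrightarrow> chart_inv c x \<in> fst c"
    using homeomorphism_image2[OF h] by blast
  show "x \<in> chart_image c \<Longrightarrow> snd c (chart_inv c x) = x"
    by (rule homeomorphism_apply2[OF h])
  show "g \<in> fst c \<Longrightarrow> snd c g \<in> chart_image c"
    by (simp add: chart_image_def)
  show "g \<in> fst c \<Longrightarrow> chart_inv c (snd c g) = g"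
    by (rule homeomorphism_apply1[OF h])
  show "continuous_on (fst c) (snd c)" "continuous_on (chart_image c) (chart_inv c)"
    using h by (auto intro: homeomorphism_cont1 homeomorphism_cont2)
qed

lemma additive_zero:
  fixes f :: "'g::monoid_add \<Rightarrow> 'b::ab_group_add"
  assumes "\<And>g h. f (g + h) = f g + f h"
  shows "f 0 = 0"
  using assms[of 0 0] by (metis add_0_left add_cancel_right_right)

context abelian_Lie_group
begin

text \<open>A translation is the smooth addition law with one argument held fixed; the fixed summand
\<open>- chart_inv c y\<close> is read in some chart \<open>d\<close> that contains it.\<close>

lemma translation_differentiable_in_chart:
  assumes c: "c \<in> atlas" "0 \<in> fst c" and y: "y \<in> chart_image c"
  shows "(\<lambda>x. snd c (chart_inv c x + - chart_inv c y)) differentiable (at y)"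
proof -
  note cc = is_chart_facts[OF charts[OF c(1)]]
  obtain d where d: "d \<in> atlas" "- chart_inv c y \<in> fst d" using cover by blast
  note cd = is_chart_facts[OF charts[OF d(1)]]
  define q where "q = snd d (- chart_inv c y)"
  have q: "q \<in> chart_image d" "chart_inv d q = - chart_inv c y"
    using cd d(2) by (auto simp: q_def)
  let ?\<phi> = "\<lambda>p. snd c (chart_inv c (fst p) + chart_inv d (snd p))"
  have "Ck_on (Suc 0) {p \<in> chart_image c \<times> chart_image d.
      chart_inv c (fst p) + chart_inv d (snd p) \<in> fst c} ?\<phi>"
    using smooth_add[OF c(1) d(1) c(1)] unfolding smooth_on_def by blast
  then have "?\<phi> differentiable (at (y, q))"
    using y q c(2) by simp
  moreover have "(\<lambda>x. (x, q)) differentiable (at y)"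
    unfolding differentiable_def by (auto intro!: derivative_eq_intros exI)
  ultimately have "(?\<phi> \<circ> (\<lambda>x. (x, q))) differentiable (at y)"
    by (intro differentiable_chain_at) auto
  then show ?thesis by (simp add: o_def q(2))
qed

text \<open>Near \<open>y\<close>, an additive \<open>f\<close> is \<open>f\<close> composed with the translation that takes \<open>y\<close> to the identity, plus a
constant. Thus its derivative at the identity controls its derivative in the whole chart.\<close>

lemma additive_has_derivative_in_chart:
  fixes f :: "'g \<Rightarrow> 'b::real_normed_vector"
  assumes c: "c \<in> atlas" "0 \<in> fst c"
    and add: "\<And>g h. f (g + h) = f g + f h"
    and der: "((\<lambda>x. f (chart_inv c x)) has_derivative T) (at (snd c 0))"
    and y: "y \<in> chart_image c"
  shows "\<exists>L. ((\<lambda>x. f (chart_inv c x)) has_derivative (\<lambda>h. T (L h))) (at y)"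
proof -
  note cc = is_chart_facts[OF charts[OF c(1)]]
  let ?k = "- chart_inv c y"
  define \<psi> where "\<psi> = (\<lambda>x. snd c (chart_inv c x + ?k))"
  obtain L where L: "(\<psi> has_derivative L) (at y)"
    using translation_differentiable_in_chart[OF c y] unfolding \<psi>_def differentiable_def by blast
  have "\<psi> y = snd c 0" by (simp add: \<psi>_def)
  then have "((\<lambda>x. f (chart_inv c (\<psi> x))) has_derivative (\<lambda>h. T (L h))) (at y)"
    using has_derivative_compose[OF L] der by simp
  then have d: "((\<lambda>x. f (chart_inv c (\<psi> x)) + f (chart_inv c y)) has_derivative (\<lambda>h. T (L h))) (at y)"
    by (auto intro!: derivative_eq_intros)
  define N where "N = chart_image c \<inter> (\<lambda>x. chart_inv c x + ?k) -` fst c"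
  have "open N"
    unfolding N_def using cc by (intro continuous_open_preimage continuous_intros) auto
  moreover have "y \<in> N" using y c(2) by (simp add: N_def)
  moreover have "f (chart_inv c (\<psi> x)) + f (chart_inv c y) = f (chart_inv c x)" if "x \<in> N" for x
    using that cc add[of "chart_inv c x + ?k" "chart_inv c y"] by (simp add: N_def \<psi>_def add)
  ultimately have "((\<lambda>x. f (chart_inv c x)) has_derivative (\<lambda>h. T (L h))) (at y)"
    by (intro has_derivative_transform_within_open[OF d])
  then show ?thesis by blast
qed

text \<open>The derivative vanishes in the whole chart, so \<open>f\<close> is zero near the identity and, by additivity, locally
constant.\<close>

lemma additive_eq_zero_if_derivative_zero:
  fixes f :: "'g \<Rightarrow> 'b::real_normed_vector"
  assumes conn: "connected (UNIV :: 'g set)" and c: "c \<in> atlas" "0 \<in> fst c"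
    and add: "\<And>g h. f (g + h) = f g + f h"
    and der: "((\<lambda>x. f (chart_inv c x)) has_derivative (\<lambda>_. 0)) (at (snd c 0))"
  shows "f g = 0"
proof -
  note cc = is_chart_facts[OF charts[OF c(1)]]
  have f0: "f 0 = 0" by (rule additive_zero[OF add])
  obtain r where r: "r > 0" "ball (snd c 0) r \<subseteq> chart_image c"
    using cc(2) cc(5)[OF c(2)] open_contains_ball by blast
  have der0: "((\<lambda>x. f (chart_inv c x)) has_derivative (\<lambda>_. 0)) (at y)" if "y \<in> chart_image c" for y
    using additive_has_derivative_in_chart[OF c add der that] by simp
  have near0: "f (chart_inv c x) = 0" if "x \<in> ball (snd c 0) r" for x
  proof -
    have "f (chart_inv c x) = f (chart_inv c (snd c 0))"
    proof (rule has_derivative_zero_unique[where f = "\<lambda>x. f (chart_inv c x)", OF convex_ball])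
      show "((\<lambda>x. f (chart_inv c x)) has_derivative (\<lambda>_. 0)) (at z within ball (snd c 0) r)"
        if "z \<in> ball (snd c 0) r" for z
        using der0[of z] r(2) that by (blast intro: has_derivative_at_withinI)
      show "snd c 0 \<in> ball (snd c 0) r" using r(1) by simp
    qed (rule that)
    then show ?thesis using cc(6) c(2) f0 by simp
  qed
  define N where "N = fst c \<inter> snd c -` ball (snd c 0) r"
  have N: "open N" "0 \<in> N"
    using continuous_open_preimage[OF cc(7) cc(1) open_ball] c(2) r(1) by (auto simp: N_def)
  have fN: "f x = 0" if "x \<in> N" for x
    using near0[of "snd c x"] that cc(6) by (simp add: N_def)
  have "f constant_on UNIV"
  proof (rule locally_constant_imp_constant[OF conn])
    fix a :: 'g
    have "open ((\<lambda>x. x - a) -` N)"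
      using N(1) by (intro open_vimage continuous_intros)
    moreover have "f x = f a" if "x \<in> (\<lambda>x. x - a) -` N" for x
      using add[of "x - a" a] fN[of "x - a"] that by simp
    moreover have "a \<in> (\<lambda>x. x - a) -` N" using N(2) by simp
    ultimately show "\<exists>T. openin (top_of_set UNIV) T \<and> a \<in> T \<and> (\<forall>x\<in>T. f x = f a)"
      unfolding subtopology_UNIV open_openin[symmetric] by blast
  qed
  then show ?thesis using f0 unfolding constant_on_def by (metis UNIV_I)
qed

text \<open>This replaces the exponential map: for an additive \<open>f\<close> with \<open>f (exp X) = T X\<close> the claim expresses that \<open>exp\<close>
is onto. Choose a linear \<open>\<sigma>\<close> with \<open>T (\<sigma> y) = y\<close> on the range of \<open>T\<close>, so that \<open>T \<circ> \<sigma>\<close> projects onto it. The additive map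
\<open>f - T \<circ> \<sigma> \<circ> f\<close> has derivative zero and hence vanishes, which puts the range of \<open>f\<close> inside that of \<open>T\<close>.
For the converse it is enough, since the range of \<open>f\<close> is a subgroup, that it contains a
neighbourhood of \<open>0\<close> in the range of \<open>T\<close>; this is an instance of the open mapping theorem for a continuous map
whose derivative at one point is invertible.\<close>

theorem range_additive_eq_range_derivative:
  fixes f :: "'g \<Rightarrow> 'v::euclidean_space"
  assumes conn: "connected (UNIV :: 'g set)" and c: "c \<in> atlas" "0 \<in> fst c"
    and add: "\<And>g h. f (g + h) = f g + f h"
    and der: "((\<lambda>x. f (chart_inv c x)) has_derivative T) (at (snd c 0))"
  shows "range f = range T"
proof -
  note cc = is_chart_facts[OF charts[OF c(1)]]
  have T: "bounded_linear T" using der by (rule has_derivative_bounded_linear)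
  then have Tlin: "linear T" by (rule bounded_linear.linear)
  define x0 where "x0 = snd c 0"
  have x0: "x0 \<in> chart_image c" "chart_inv c x0 = 0" using cc c(2) by (auto simp: x0_def)
  obtain \<sigma> where \<sigma>: "linear \<sigma>" "\<And>y. y \<in> range T \<Longrightarrow> T (\<sigma> y) = y"
    using linear_exists_right_inverse_on[OF Tlin subspace_UNIV] by auto
  have \<sigma>b: "bounded_linear \<sigma>" using \<sigma>(1) by (simp add: linear_conv_bounded_linear)
  have T\<sigma>: "bounded_linear (\<lambda>y. T (\<sigma> y))" using bounded_linear_compose[OF T \<sigma>b] .
  have sub: "range f \<subseteq> range T"
  proof -
    have "f g - T (\<sigma> (f g)) = 0" for g
    proof (rule additive_eq_zero_if_derivative_zero[OF conn c])
      show "f (g + h) - T (\<sigma> (f (g + h))) = f g - T (\<sigma> (f g)) + (f h - T (\<sigma> (f h)))" for g h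
        using linear_add[OF \<sigma>(1)] linear_add[OF Tlin] by (simp add: add)
      have "((\<lambda>x. f (chart_inv c x) - T (\<sigma> (f (chart_inv c x)))) has_derivative
          (\<lambda>h. T h - T (\<sigma> (T h)))) (at (snd c 0))"
        by (intro has_derivative_diff der bounded_linear.has_derivative[OF T\<sigma>])
      then show "((\<lambda>x. f (chart_inv c x) - T (\<sigma> (f (chart_inv c x)))) has_derivative (\<lambda>_. 0)) (at (snd c 0))"
        using \<sigma>(2) by simp
    qed
    then show ?thesis by (metis eq_iff_diff_eq_0 image_subsetI rangeI)
  qed
  define S where "S = (\<lambda>w. x0 + \<sigma> w) -` chart_image c"
  have \<sigma>cont: "continuous_on A \<sigma>" for A
    using \<sigma>b by (simp add: linear_continuous_on)
  have S: "open S" "0 \<in> S"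
    unfolding S_def using cc(2) x0(1) linear_0[OF \<sigma>(1)]
    by (auto intro!: open_vimage continuous_intros \<sigma>cont)
  \<comment> \<open>The summand \<open>w - T (\<sigma> w)\<close> fills the directions missing from the range of \<open>T\<close>, so that the derivative at \<open>0\<close> is
  the identity of the full space. If \<open>F w\<close> lies in the range of \<open>T\<close>, then so does \<open>w\<close>, and the summand vanishes.\<close>
  define F where "F = (\<lambda>w. f (chart_inv c (x0 + \<sigma> w)) + (w - T (\<sigma> w)))"
  have contf: "continuous_on (chart_image c) (\<lambda>x. f (chart_inv c x))"
  proof (intro continuous_at_imp_continuous_on ballI)
    fix y assume "y \<in> chart_image c"
    then obtain L where "((\<lambda>x. f (chart_inv c x)) has_derivative (\<lambda>h. T (L h))) (at y)"
      using additive_has_derivative_in_chart[OF c add der] by blast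
    then show "isCont (\<lambda>x. f (chart_inv c x)) y" by (rule has_derivative_continuous)
  qed
  have "continuous_on S F"
    unfolding F_def S_def using T\<sigma>
    by (intro continuous_intros continuous_on_compose2[OF contf] \<sigma>cont linear_continuous_on) auto
  moreover have "(F has_derivative id) (at 0)"
  proof -
    have "((\<lambda>w. x0 + \<sigma> w) has_derivative \<sigma>) (at 0)"
      using bounded_linear_imp_has_derivative[OF \<sigma>b] by (auto intro!: derivative_eq_intros)
    then have "((\<lambda>w. f (chart_inv c (x0 + \<sigma> w))) has_derivative (\<lambda>w. T (\<sigma> w))) (at 0)"
      using has_derivative_compose[of "\<lambda>w. x0 + \<sigma> w" \<sigma> 0 UNIV] der linear_0[OF \<sigma>(1)]
      by (simp add: x0_def)
    then have "(F has_derivative (\<lambda>w. T (\<sigma> w) + (w - T (\<sigma> w)))) (at 0)"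
      unfolding F_def
      by (intro has_derivative_add has_derivative_diff has_derivative_ident
          bounded_linear_imp_has_derivative[OF T\<sigma>])
    then show ?thesis by (simp add: id_def)
  qed
  ultimately have "F 0 \<in> interior (F ` S)"
    using S by (intro sussmann_open_mapping[where f' = id and g' = id and S = S])
      (auto simp: interior_open bounded_linear_ident[folded id_def])
  moreover have "F 0 = 0"
    using linear_0[OF \<sigma>(1)] linear_0[OF Tlin] x0(2) additive_zero[OF add] by (simp add: F_def)
  ultimately obtain r where r: "r > 0" "ball 0 r \<subseteq> F ` S"
    by (auto simp: mem_interior)
  have small: "y \<in> range f" if y: "y \<in> range T" "norm y < r" for y
  proof -
    have "y \<in> F ` S" using r(2) y(2) by auto
    then obtain w where w: "w \<in> S" "y = F w" by blast
    have subT: "subspace (range T)" using Tlin by (simp add: linear_subspace_image)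
    have "w = (y - f (chart_inv c (x0 + \<sigma> w))) + T (\<sigma> w)" using w(2) by (simp add: F_def)
    moreover have "\<dots> \<in> range T"
      using y(1) sub by (intro subspace_add[OF subT] subspace_diff[OF subT]) auto
    ultimately have "w \<in> range T" by simp
    then have "T (\<sigma> w) = w" by (rule \<sigma>(2))
    then show ?thesis using w(2) by (simp add: F_def)
  qed
  have mult: "\<exists>h. f h = real n *\<^sub>R f g" for n g
  proof (induction n)
    case 0
    then show ?case using additive_zero[OF add] by auto
  next
    case (Suc n)
    then obtain h where "f h = real n *\<^sub>R f g" by blast
    then have "f (h + g) = real (Suc n) *\<^sub>R f g" by (simp add: add algebra_simps)
    then show ?case by blast
  qed
  have "y \<in> range f" if y: "y \<in> range T" for y
  proof -
    obtain n where n: "norm y / r < real (Suc n)"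
      using reals_Archimedean2 by (metis less_trans lessI of_nat_less_iff)
    define z where "z = y /\<^sub>R real (Suc n)"
    have "z \<in> range T"
      using y Tlin unfolding z_def by (intro subspace_scale linear_subspace_image) auto
    moreover have "norm z < r"
      using n r(1) by (simp add: z_def field_simps)
    ultimately have "z \<in> range f" by (rule small)
    then obtain g where "f g = z" by auto
    then have "real (Suc n) *\<^sub>R f g = y" by (simp add: z_def)
    then show ?thesis using mult[of "Suc n" g] by (metis rangeI)
  qed
  then show ?thesis using sub by blast
qed

end

section \<open>Weights and moment map of simultaneously diagonal operators\<close>

text \<open>The situation of the weight decomposition, refined to an orthonormal basis: the basis vector \<open>e\<close> has
weight \<open>\<alpha> e\<close>, and different basis vectors may share a weight.\<close>

locale diagonal_operators =
  fixes E :: "'v::euclidean_space set" and \<alpha> :: "'v \<Rightarrow> 'a::real_inner"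
    and \<pi> :: "'a \<Rightarrow> 'v \<Rightarrow> 'v"
  assumes finite_E: "finite E" and orth_E: "pairwise orthogonal E"
    and unit_E: "e \<in> E \<Longrightarrow> norm e = 1" and span_E: "span E = UNIV"
    and diagonal: "\<pi> X w = (\<Sum>e\<in>E. ((w \<bullet> e) * (X \<bullet> \<alpha> e)) *\<^sub>R e)"
begin

lemma inner_sum_basis:
  assumes "e \<in> E"
  shows "(\<Sum>b\<in>E. t b *\<^sub>R b) \<bullet> e = t e"
proof -
  have "(\<Sum>b\<in>E. t b *\<^sub>R b) \<bullet> e = (\<Sum>b\<in>E. if b = e then t e else 0)"
    unfolding inner_sum_left
  proof (intro sum.cong refl)
    fix b assume "b \<in> E"
    then show "t b *\<^sub>R b \<bullet> e = (if b = e then t e else 0)"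
      using orth_E unit_E[OF assms] assms
      by (auto simp: pairwise_def orthogonal_def dot_square_norm)
  qed
  then show ?thesis using finite_E assms by simp
qed

lemma basis_expansion: "w = (\<Sum>e\<in>E. (w \<bullet> e) *\<^sub>R e)"
  by (rule orthonormal_expansion[OF finite_E orth_E unit_E]) (simp_all add: span_E)

lemma eq_if_coordinates_eq: "(\<And>e. e \<in> E \<Longrightarrow> u \<bullet> e = w \<bullet> e) \<Longrightarrow> u = w"
  using basis_expansion[of u] basis_expansion[of w] by (metis (no_types, lifting) sum.cong)

lemma weight_space_iff: "w \<in> weight_space \<pi> \<beta> \<longleftrightarrow> (\<forall>e\<in>E. w \<bullet> e \<noteq> 0 \<longrightarrow> \<alpha> e = \<beta>)"
proof
  assume w: "w \<in> weight_space \<pi> \<beta>"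
  show "\<forall>e\<in>E. w \<bullet> e \<noteq> 0 \<longrightarrow> \<alpha> e = \<beta>"
  proof (intro ballI impI)
    fix e assume e: "e \<in> E" "w \<bullet> e \<noteq> 0"
    have "X \<bullet> \<alpha> e = X \<bullet> \<beta>" for X
    proof -
      have "\<pi> X w \<bullet> e = ((X \<bullet> \<beta>) *\<^sub>R w) \<bullet> e" using w by (simp add: weight_space_def)
      then show ?thesis using e unfolding diagonal inner_sum_basis[OF e(1)] by simp
    qed
    then show "\<alpha> e = \<beta>" using vector_eq_rdot by (metis inner_commute)
  qed
next
  assume w: "\<forall>e\<in>E. w \<bullet> e \<noteq> 0 \<longrightarrow> \<alpha> e = \<beta>"
  have "\<pi> X w = (X \<bullet> \<beta>) *\<^sub>R w" for X
    by (rule eq_if_coordinates_eq) (use w in \<open>auto simp: diagonal inner_sum_basis\<close>)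
  then show "w \<in> weight_space \<pi> \<beta>" by (simp add: weight_space_def)
qed

lemma basis_in_weight_space: "e \<in> E \<Longrightarrow> e \<in> weight_space \<pi> (\<alpha> e)"
  using orth_E by (auto simp: weight_space_iff pairwise_def orthogonal_def)

lemma weights_eq: "weights \<pi> = \<alpha> ` E"
proof
  show "weights \<pi> \<subseteq> \<alpha> ` E"
  proof
    fix \<beta> assume "\<beta> \<in> weights \<pi>"
    moreover have "0 \<in> weight_space \<pi> \<beta>" by (simp add: weight_space_iff)
    ultimately obtain w where w: "w \<in> weight_space \<pi> \<beta>" "w \<noteq> 0"
      unfolding weights_def by blast
    then obtain e where "e \<in> E" "w \<bullet> e \<noteq> 0"
      using eq_if_coordinates_eq[of w 0] by auto
    then show "\<beta> \<in> \<alpha> ` E" using w(1) by (auto simp: weight_space_iff)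
  qed
  show "\<alpha> ` E \<subseteq> weights \<pi>"
    using basis_in_weight_space unit_E by (force simp: weights_def)
qed

lemma weight_component_eq:
  "weight_component \<pi> v = (\<lambda>\<beta>. \<Sum>e\<in>E. (if \<alpha> e = \<beta> then v \<bullet> e else 0) *\<^sub>R e)"
  unfolding weight_component_def
proof (rule the_equality, intro conjI allI)
  let ?c = "\<lambda>\<beta>. \<Sum>e\<in>E. (if \<alpha> e = \<beta> then v \<bullet> e else 0) *\<^sub>R e"
  show "?c \<beta> \<in> weight_space \<pi> \<beta>" for \<beta>
    unfolding weight_space_iff using inner_sum_basis by (auto split: if_splits)
  show "v = (\<Sum>\<beta>\<in>weights \<pi>. ?c \<beta>)"
  proof (rule eq_if_coordinates_eq)
    fix e assume e: "e \<in> E"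
    show "v \<bullet> e = (\<Sum>\<beta>\<in>weights \<pi>. ?c \<beta>) \<bullet> e"
      by (subst inner_sum_left) (use e finite_E in \<open>simp add: inner_sum_basis weights_eq\<close>)
  qed
next
  fix c assume c: "(\<forall>\<beta>. c \<beta> \<in> weight_space \<pi> \<beta>) \<and> v = (\<Sum>\<beta>\<in>weights \<pi>. c \<beta>)"
  show "c = (\<lambda>\<beta>. \<Sum>e\<in>E. (if \<alpha> e = \<beta> then v \<bullet> e else 0) *\<^sub>R e)"
  proof (intro ext eq_if_coordinates_eq)
    fix \<beta> e assume e: "e \<in> E"
    \<comment> \<open>Uniqueness: only the component in the weight space of \<open>\<alpha> e\<close> contributes to the coordinate along \<open>e\<close>.\<close>
    have zero: "c \<gamma> \<bullet> e = 0" if "\<gamma> \<noteq> \<alpha> e" for \<gamma>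
      using c e that by (auto simp: weight_space_iff)
    have "v \<bullet> e = (\<Sum>\<gamma>\<in>weights \<pi>. c \<gamma> \<bullet> e)"
      using c by (metis inner_sum_left)
    also have "\<dots> = (\<Sum>\<gamma>\<in>weights \<pi>. if \<gamma> = \<alpha> e then c (\<alpha> e) \<bullet> e else 0)"
      using zero by (intro sum.cong) auto
    also have "\<dots> = c (\<alpha> e) \<bullet> e"
      using e finite_E by (simp add: weights_eq)
    finally show "c \<beta> \<bullet> e = (\<Sum>e\<in>E. (if \<alpha> e = \<beta> then v \<bullet> e else 0) *\<^sub>R e) \<bullet> e"
      unfolding inner_sum_basis[OF e] using zero[of \<beta>] by auto
  qed
qed

lemma weight_support_eq: "weight_support \<pi> v = \<alpha> ` {e\<in>E. v \<bullet> e \<noteq> 0}"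
proof (intro equalityI subsetI)
  fix \<beta> assume "\<beta> \<in> weight_support \<pi> v"
  then have "weight_component \<pi> v \<beta> \<noteq> 0" by (simp add: weight_support_def)
  then obtain e where "e \<in> E" "weight_component \<pi> v \<beta> \<bullet> e \<noteq> 0"
    using eq_if_coordinates_eq[of "weight_component \<pi> v \<beta>" 0] by auto
  then show "\<beta> \<in> \<alpha> ` {e\<in>E. v \<bullet> e \<noteq> 0}"
    unfolding weight_component_eq using inner_sum_basis by (auto split: if_splits)
next
  fix \<beta> assume "\<beta> \<in> \<alpha> ` {e\<in>E. v \<bullet> e \<noteq> 0}"
  then obtain e where e: "e \<in> E" "v \<bullet> e \<noteq> 0" "\<beta> = \<alpha> e" by auto
  have "weight_component \<pi> v \<beta> \<bullet> e = v \<bullet> e"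
    unfolding weight_component_eq inner_sum_basis[OF e(1)] using e(3) by simp
  then have "weight_component \<pi> v \<beta> \<noteq> 0" using e(2) by auto
  then show "\<beta> \<in> weight_support \<pi> v" using e by (simp add: weight_support_def weights_eq)
qed

lemma norm_square_eq: "(norm w)\<^sup>2 = (\<Sum>e\<in>E. (w \<bullet> e)\<^sup>2)"
proof -
  have "(norm w)\<^sup>2 = w \<bullet> (\<Sum>e\<in>E. (w \<bullet> e) *\<^sub>R e)"
    by (simp only: basis_expansion[symmetric] power2_norm_eq_inner)
  then show ?thesis by (simp add: inner_sum_right power2_eq_square)
qed

lemma moment_map_eq:
  "moment_map \<pi> w = (1 / (\<Sum>e\<in>E. (w \<bullet> e)\<^sup>2)) *\<^sub>R (\<Sum>e\<in>E. (w \<bullet> e)\<^sup>2 *\<^sub>R \<alpha> e)" (is "_ = ?m")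
  unfolding moment_map_def
proof (rule the_equality)
  have "\<pi> X w \<bullet> w = (\<Sum>e\<in>E. (w \<bullet> e)\<^sup>2 * (X \<bullet> \<alpha> e))" for X
    by (simp add: diagonal inner_sum_right power2_eq_square inner_commute[of _ w] ac_simps)
  then show m: "\<forall>X. ?m \<bullet> X = \<pi> X w \<bullet> w / (norm w)\<^sup>2"
    by (simp add: norm_square_eq inner_sum_left inner_commute[of "\<alpha> _"])
  show "m = ?m" if "\<forall>X. m \<bullet> X = \<pi> X w \<bullet> w / (norm w)\<^sup>2" for m
    using m that vector_eq_rdot by metis
qed

text \<open>Squaring the coordinates doubles the exponents, so the moment map sends the point with parameter \<open>X\<close> to
the exponential mean of the weights in the support with parameter \<open>2 X\<close>.\<close>

theorem moment_map_exponential_orbit: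
  assumes "v \<noteq> 0"
  shows "range (\<lambda>X. moment_map \<pi> (\<Sum>e\<in>E. (exp (X \<bullet> \<alpha> e) * (v \<bullet> e)) *\<^sub>R e))
    = rel_interior (convex hull (weight_support \<pi> v))"
proof -
  define I where "I = {e\<in>E. v \<bullet> e \<noteq> 0}"
  define M where "M = (\<lambda>X. (1 / (\<Sum>e\<in>I. (v \<bullet> e)\<^sup>2 * exp (X \<bullet> \<alpha> e))) *\<^sub>R
    (\<Sum>e\<in>I. ((v \<bullet> e)\<^sup>2 * exp (X \<bullet> \<alpha> e)) *\<^sub>R \<alpha> e))"
  have I: "finite I" "I \<noteq> {}"
    using finite_E assms eq_if_coordinates_eq[of v 0] by (auto simp: I_def)
  have "moment_map \<pi> (\<Sum>e\<in>E. (exp (X \<bullet> \<alpha> e) * (v \<bullet> e)) *\<^sub>R e) = M (2 *\<^sub>R X)" for X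
  proof -
    let ?w = "\<Sum>e\<in>E. (exp (X \<bullet> \<alpha> e) * (v \<bullet> e)) *\<^sub>R e"
    have w: "(?w \<bullet> e)\<^sup>2 = (v \<bullet> e)\<^sup>2 * exp ((2 *\<^sub>R X) \<bullet> \<alpha> e)" if "e \<in> E" for e
      using that by (simp add: inner_sum_basis power_mult_distrib exp_double mult.commute)
    have "(\<Sum>e\<in>E. (?w \<bullet> e)\<^sup>2) = (\<Sum>e\<in>I. (v \<bullet> e)\<^sup>2 * exp ((2 *\<^sub>R X) \<bullet> \<alpha> e))"
      using finite_E w by (intro sum.mono_neutral_cong_right) (auto simp: I_def)
    moreover have "(\<Sum>e\<in>E. (?w \<bullet> e)\<^sup>2 *\<^sub>R \<alpha> e) = (\<Sum>e\<in>I. ((v \<bullet> e)\<^sup>2 * exp ((2 *\<^sub>R X) \<bullet> \<alpha> e)) *\<^sub>R \<alpha> e)"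
      using finite_E w by (intro sum.mono_neutral_cong_right) (auto simp: I_def)
    ultimately show ?thesis by (simp only: moment_map_eq M_def)
  qed
  moreover have "range (\<lambda>X. M (2 *\<^sub>R X)) = range M"
  proof -
    have "M X \<in> range (\<lambda>X. M (2 *\<^sub>R X))" for X
      by (rule range_eqI[of _ _ "(1/2) *\<^sub>R X"]) simp
    then show ?thesis by blast
  qed
  moreover have "range M = rel_interior (convex hull (\<alpha> ` I))"
    unfolding M_def using I by (intro rel_interior_convex_hull_eq_exponential_means) (auto simp: I_def)
  ultimately show ?thesis by (simp add: weight_support_eq I_def)
qed

end

section \<open>Orbits of an action by symmetric operators\<close>

lemma (in abelian_Lie_group) smooth_linear_action_orbit_differentiable:
  fixes \<rho> :: "'g \<Rightarrow> 'v::real_normed_vector \<Rightarrow> 'v"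
  assumes "smooth_linear_action atlas \<rho>" and "c \<in> atlas" and "x \<in> chart_image c"
  shows "(\<lambda>x. \<rho> (chart_inv c x) w) differentiable (at x)"
proof -
  have "Ck_on (Suc 0) (chart_image c \<times> UNIV) (\<lambda>p. \<rho> (chart_inv c (fst p)) (snd p))"
    using assms(1,2) unfolding smooth_linear_action_def smooth_on_def by blast
  then have "(\<lambda>p. \<rho> (chart_inv c (fst p)) (snd p)) differentiable (at (x, w))"
    using assms(3) by simp
  moreover have "(\<lambda>x. (x, w)) differentiable (at x)"
    unfolding differentiable_def by (auto intro!: derivative_eq_intros exI)
  ultimately have "((\<lambda>p. \<rho> (chart_inv c (fst p)) (snd p)) \<circ> (\<lambda>x. (x, w))) differentiable (at x)"
    by (intro differentiable_chain_at) auto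
  then show ?thesis by (simp add: o_def)
qed

lemma (in abelian_Lie_group) smooth_linear_action_orbit_continuous:
  fixes \<rho> :: "'g \<Rightarrow> 'v::real_normed_vector \<Rightarrow> 'v"
  assumes "smooth_linear_action atlas \<rho>"
  shows "continuous_on UNIV (\<lambda>g. \<rho> g w)"
proof (intro continuous_at_imp_continuous_on ballI)
  fix g :: 'g
  obtain c where c: "c \<in> atlas" "g \<in> fst c" using cover by blast
  note cc = is_chart_facts[OF charts[OF c(1)]]
  have "continuous_on (chart_image c) (\<lambda>x. \<rho> (chart_inv c x) w)"
    using smooth_linear_action_orbit_differentiable[OF assms c(1)]
    by (intro differentiable_imp_continuous_on differentiable_at_imp_differentiable_on)
  then have "continuous_on (fst c) (\<lambda>h. \<rho> (chart_inv c (snd c h)) w)"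
    by (rule continuous_on_compose2[OF _ cc(7)]) (use cc(5) in blast)
  then have "continuous_on (fst c) (\<lambda>h. \<rho> h w)"
    using cc(6) by (simp cong: continuous_on_cong)
  then show "isCont (\<lambda>g. \<rho> g w) g"
    using cc(1) c(2) continuous_on_eq_continuous_at by blast
qed

text \<open>The eigenvalue is a continuous function of \<open>g\<close> without zeros, because \<open>\<rho> g\<close> is invertible, and equals
\<open>1\<close> at the identity.\<close>

lemma (in abelian_Lie_group) joint_eigenvalue_positive:
  fixes \<rho> :: "'g \<Rightarrow> 'v::real_inner \<Rightarrow> 'v"
  assumes conn: "connected (UNIV :: 'g set)" and \<rho>: "smooth_linear_action atlas \<rho>"
    and e: "norm e = 1" "\<And>g. \<exists>\<mu>. \<rho> g e = \<mu> *\<^sub>R e"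
  shows "\<rho> g e \<bullet> e > 0"
proof -
  have "\<rho> h e \<bullet> e \<noteq> 0" for h
  proof
    assume zero: "\<rho> h e \<bullet> e = 0"
    obtain \<mu> where \<mu>: "\<rho> h e = \<mu> *\<^sub>R e" using e(2) by blast
    then have "\<rho> h e = 0" using zero e(1) by (simp add: dot_square_norm)
    moreover have "\<rho> (- h) (\<rho> h e) = \<rho> (- h + h) e"
      using \<rho> unfolding smooth_linear_action_def by (metis comp_apply)
    moreover have "\<rho> (- h + h) e = e"
      using \<rho> unfolding smooth_linear_action_def by simp
    moreover have "\<rho> (- h) 0 = 0"
      using \<rho> unfolding smooth_linear_action_def by (blast intro: linear_0)
    ultimately show False using e(1) by auto
  qed
  moreover have "connected (range (\<lambda>g. \<rho> g e \<bullet> e))"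
    by (intro connected_continuous_image conn continuous_on_inner continuous_on_const
        smooth_linear_action_orbit_continuous[OF \<rho>])
  moreover have "1 \<in> range (\<lambda>g. \<rho> g e \<bullet> e)"
    using \<rho> e(1) by (auto simp: smooth_linear_action_def dot_square_norm intro!: image_eqI[of _ _ 0])
  ultimately show ?thesis
    unfolding connected_iff_interval
    by (metis (no_types, lifting) not_less rangeE rangeI zero_le_one)
qed

theorem proposition3p1:
  fixes atlas :: "('g::{topological_ab_group_add, t2_space, second_countable_topology},
                   'a::real_inner) chart set"
    and c :: "('g, 'a) chart"
    and \<rho> :: "'g \<Rightarrow> 'v::euclidean_space \<Rightarrow> 'v"
    and \<pi> :: "'a \<Rightarrow> 'v \<Rightarrow> 'v"
    and v :: 'v
  assumes "abelian_Lie_group atlas"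
    and "connected (UNIV :: 'g set)"
    and "no_compact_factor TYPE('g)"
    and "c \<in> atlas" and "0 \<in> fst c"
    and "smooth_linear_action atlas \<rho>"
    and "\<And>g. symmetric_op (\<rho> g)"
    and "\<pi> = differential c \<rho>"
    and "v \<noteq> 0"
  shows "moment_map \<pi> ` range (\<lambda>g. \<rho> g v) = rel_interior (convex hull (weight_support \<pi> v))"
proof -
  interpret abelian_Lie_group atlas by fact
  note conn = assms(2) and c = assms(4,5) and \<rho> = assms(6)
  have lin: "linear (\<rho> g)" and \<rho>0: "\<rho> 0 = id" and hom: "\<rho> (g + h) w = \<rho> g (\<rho> h w)" for g h w
    using \<rho> by (auto simp: smooth_linear_action_def)
  have comm: "\<rho> g (\<rho> h w) = \<rho> h (\<rho> g w)" for g h w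
    by (metis add.commute hom)
  obtain E where E: "finite E" "pairwise orthogonal E" "\<And>e. e \<in> E \<Longrightarrow> norm e = 1" "span E = UNIV"
    and eig: "\<And>e g. e \<in> E \<Longrightarrow> \<exists>\<mu>. \<rho> g e = \<mu> *\<^sub>R e"
    using commuting_symmetric_ops_joint_eigenbasis[where f = \<rho>, OF lin assms(7) comm] by metis
  define x0 where "x0 = snd c 0"
  note cc = is_chart_facts[OF charts[OF c(1)]]
  have x0: "x0 \<in> chart_image c" "chart_inv c x0 = 0" using cc c(2) by (auto simp: x0_def)

  have \<pi>_der: "((\<lambda>x. \<rho> (chart_inv c x) w) has_derivative (\<lambda>X. \<pi> X w)) (at x0)" for w
    using smooth_linear_action_orbit_differentiable[OF \<rho> c(1) x0(1)]
    unfolding assms(8) differential_def x0_def by (simp add: frechet_derivative_works)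

  \<comment> \<open>The character by which the group acts on the line through \<open>e\<close>.\<close>
  define \<theta> where "\<theta> = (\<lambda>e g. \<rho> g e \<bullet> e)"
  have \<rho>_e: "\<rho> g e = \<theta> e g *\<^sub>R e" if "e \<in> E" for e g
    using eig[OF that, of g] E(3)[OF that] by (auto simp: \<theta>_def dot_square_norm)
  have \<theta>_add: "\<theta> e (g + h) = \<theta> e g * \<theta> e h" if "e \<in> E" for e g h
  proof -
    have "\<rho> (g + h) e = \<rho> g (\<theta> e h *\<^sub>R e)" unfolding hom by (simp only: \<rho>_e[OF that, of h])
    also have "\<dots> = (\<theta> e h * \<theta> e g) *\<^sub>R e" by (simp only: linear_cmul[OF lin] \<rho>_e[OF that] scaleR_scaleR)
    finally have "\<rho> (g + h) e \<bullet> e = \<theta> e g * \<theta> e h"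
      using E(3)[OF that] by (simp add: dot_square_norm)
    then show ?thesis by (simp add: \<theta>_def)
  qed
  have \<theta>_pos: "\<theta> e g > 0" if "e \<in> E" for e g
    using joint_eigenvalue_positive[OF conn \<rho> E(3)[OF that] eig[OF that]] by (simp add: \<theta>_def)
  have \<theta>_der: "((\<lambda>x. \<theta> e (chart_inv c x)) has_derivative (\<lambda>X. \<pi> X e \<bullet> e)) (at x0)" for e
    unfolding \<theta>_def by (intro has_derivative_inner_left \<pi>_der)

  have "\<exists>\<beta>. \<forall>X. \<pi> X e \<bullet> e = X \<bullet> \<beta>" for e
  proof -
    obtain B :: "'a set" where "finite B" "span B = UNIV" using finite_dim by blast
    moreover have "linear (\<lambda>X. \<pi> X e \<bullet> e)"
      using has_derivative_bounded_linear[OF \<theta>_der] by (rule bounded_linear.linear)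
    ultimately show ?thesis by (rule riesz_representation_finite_dim)
  qed
  then obtain \<alpha> where \<alpha>: "\<And>X e. \<pi> X e \<bullet> e = X \<bullet> \<alpha> e" by metis

  have \<rho>_expand: "\<rho> g w = (\<Sum>e\<in>E. ((w \<bullet> e) * \<theta> e g) *\<^sub>R e)" for g w
  proof -
    have "w = (\<Sum>e\<in>E. (w \<bullet> e) *\<^sub>R e)"
      by (rule orthonormal_expansion[OF E(1-3)]) (simp_all add: E(4))
    then have "\<rho> g w = \<rho> g (\<Sum>e\<in>E. (w \<bullet> e) *\<^sub>R e)" by simp
    also have "\<dots> = (\<Sum>e\<in>E. (w \<bullet> e) *\<^sub>R \<rho> g e)"
      using lin by (simp add: linear_sum linear_cmul)
    also have "\<dots> = (\<Sum>e\<in>E. ((w \<bullet> e) * \<theta> e g) *\<^sub>R e)"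
      using \<rho>_e by (intro sum.cong) auto
    finally show ?thesis .
  qed

  interpret diagonal_operators E \<alpha> \<pi>
  proof
    fix X w
    have "((\<lambda>x. \<Sum>e\<in>E. ((w \<bullet> e) * \<theta> e (chart_inv c x)) *\<^sub>R e) has_derivative
        (\<lambda>X. \<Sum>e\<in>E. ((w \<bullet> e) * (X \<bullet> \<alpha> e)) *\<^sub>R e)) (at x0)"
      using \<theta>_der unfolding \<alpha>
      by (intro has_derivative_sum has_derivative_scaleR_left has_derivative_mult_right)
    then have "((\<lambda>x. \<rho> (chart_inv c x) w) has_derivative
        (\<lambda>X. \<Sum>e\<in>E. ((w \<bullet> e) * (X \<bullet> \<alpha> e)) *\<^sub>R e)) (at x0)"
      by (simp only: \<rho>_expand)
    then have "(\<lambda>X. \<pi> X w) = (\<lambda>X. \<Sum>e\<in>E. ((w \<bullet> e) * (X \<bullet> \<alpha> e)) *\<^sub>R e)"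
      using \<pi>_der has_derivative_unique by blast
    then show "\<pi> X w = (\<Sum>e\<in>E. ((w \<bullet> e) * (X \<bullet> \<alpha> e)) *\<^sub>R e)" by metis
  qed (use E in auto)

  \<comment> \<open>All logarithms of the characters, gathered into one additive map with values in \<open>'v\<close>, whose derivative
  at the identity gathers the weights. Equality of the ranges says that the tuples of eigenvalues
  attained by the group are exactly the tuples \<open>exp (X \<bullet> \<alpha> e)\<close>.\<close>
  define \<Lambda> where "\<Lambda> = (\<lambda>g. \<Sum>e\<in>E. ln (\<theta> e g) *\<^sub>R e)"
  define T where "T = (\<lambda>X. \<Sum>e\<in>E. (X \<bullet> \<alpha> e) *\<^sub>R e)"
  have "range \<Lambda> = range T"
  proof (rule range_additive_eq_range_derivative[OF conn c])
    show "\<Lambda> (g + h) = \<Lambda> g + \<Lambda> h" for g h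
      unfolding \<Lambda>_def sum.distrib[symmetric]
      using \<theta>_add \<theta>_pos by (intro sum.cong) (auto simp: ln_mult algebra_simps less_imp_neq[THEN not_sym])
    have "((\<lambda>x. ln (\<theta> e (chart_inv c x))) has_derivative (\<lambda>X. X \<bullet> \<alpha> e)) (at x0)" if e: "e \<in> E" for e
    proof -
      have "\<theta> e (chart_inv c x0) = 1"
        using x0(2) \<rho>0 E(3)[OF e] by (simp add: \<theta>_def dot_square_norm)
      then show ?thesis
        using has_derivative_ln[OF _ \<theta>_der, of e] by (simp add: \<alpha>)
    qed
    then show "((\<lambda>x. \<Lambda> (chart_inv c x)) has_derivative T) (at (snd c 0))"
      unfolding \<Lambda>_def T_def x0_def[symmetric]
      by (intro has_derivative_sum has_derivative_scaleR_left)
  qed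
  moreover have orbit: "\<rho> g v = (\<Sum>e\<in>E. (exp (\<Lambda> g \<bullet> e) * (v \<bullet> e)) *\<^sub>R e)" for g
    unfolding \<rho>_expand \<Lambda>_def using inner_sum_basis \<theta>_pos by (intro sum.cong) auto
  ultimately have "range (\<lambda>g. \<rho> g v) = (\<lambda>X. \<Sum>e\<in>E. (exp (T X \<bullet> e) * (v \<bullet> e)) *\<^sub>R e) ` UNIV"
  proof -
    let ?h = "\<lambda>l. \<Sum>e\<in>E. (exp (l \<bullet> e) * (v \<bullet> e)) *\<^sub>R e"
    have "range (\<lambda>g. \<rho> g v) = ?h ` range \<Lambda>" unfolding orbit by auto
    also have "\<dots> = ?h ` range T" using \<open>range \<Lambda> = range T\<close> by simp
    finally show ?thesis by (simp add: image_image)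
  qed
  also have "\<dots> = range (\<lambda>X. \<Sum>e\<in>E. (exp (X \<bullet> \<alpha> e) * (v \<bullet> e)) *\<^sub>R e)"
    unfolding T_def by (intro image_cong sum.cong refl) (simp add: inner_sum_basis)
  finally show ?thesis
    using moment_map_exponential_orbit[OF assms(9)] by (simp add: image_image)
qed

end
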